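(* Let $(m,r)\in\mathcal R_1$, and let $\mu>0$ and $-\frac1\mu<\pi<1$. If $$-\min\Bigl(\frac rm,1\Bigr)<\pi\mu<\frac{r}{1-m}\quad\text{and}\quad\mu>\frac{r}{1-m},$$ then there exists a (strictly) stationary INAR(1) process with parameters $(m,r)$ whose marginal distribution is the zero-modified geometric distribution ZMG$(\pi,\mu)$, equivalently the BerG$(m',r')$ distribution with $m'=\mu(1-\pi)$ and $r'=\mu$.
   Context: $\mathcal R=\{(m,r)\in\mathbb R^2: r\ge 0,\ 0<m\le r+1\}$ and $\mathcal R_1=\{(m,r)\in\mathbb R^2: r\ge 0,\ 0<m<1\}$. For $(m,r)\in\mathcal R$, $\psi_{m,r}(s)=1-m\frac{1-s}{1+r(1-s)}$, $s\in[0,1]$ (a probability generating function, pgf); BerG$(m,r)$ is the distribution on $\mathbb Z_+$ with pgf $\psi_{m,r}$. For $\mu>0$ and $-1/\mu<\pi<1$, ZMG$(\pi,\mu)$ is the distribution on $\mathbb Z_+$ with pgf $\frac{1+\pi\mu(1-s)}{1+\mu(1-s)}$, which equals $\psi_{m',r'}(s)$ for $m'=\mu(1-\pi)$, $r'=\mu$. For $(m,r)\in\mathcal R_1$, an INAR(1) process with parameters $(m,r)$ is a sequence $(X_t,t\ge0)$ of $\mathbb Z_+$-valued random variables such that for every $t\ge1$, $$X_t=\sum_{i=1}^{X_{t-1}}Z_{i,t-1}+\epsilon_t,$$ where $(Z_{i,t})$ is an array of iid $\mathbb Z_+$-valued random variables with common pgf $\psi_{m,r}$, $(\epsilon_t,t\ge1)$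 is an iid sequence of $\mathbb Z_+$-valued random variables, and $X_0$, $(\epsilon_t)$ and $(Z_{i,t})$ are mutually independent. *)

theory Defs
  imports "HOL-Probability.Probability"
begin

definition params_R :: "(real \<times> real) set" where
  "params_R = {(m, r). r \<ge> 0 \<and> 0 < m \<and> m \<le> r + 1}"

definition params_R1 :: "(real \<times> real) set" where
  "params_R1 = {(m, r). r \<ge> 0 \<and> 0 < m \<and> m < 1}"

definition berg_pgf :: "real \<Rightarrow> real \<Rightarrow> real \<Rightarrow> real" where
  "berg_pgf m r s = 1 - m * ((1 - s) / (1 + r * (1 - s)))"

definition zmg_pgf :: "real \<Rightarrow> real \<Rightarrow> real \<Rightarrow> real" where
  "zmg_pgf \<pi> \<mu> s = (1 + \<pi> * \<mu> * (1 - s)) / (1 + \<mu> * (1 - s))"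

text \<open>\<open>N\<close> is a probability distribution on the nonnegative integers (with every subset measurable)
  whose probability generating function agrees with \<open>G\<close> on \<open>[0, 1]\<close>; note that \<open>0 ^ 0 = 1\<close>.
  Such an \<open>N\<close> is uniquely determined by \<open>G\<close>.\<close>

definition has_pgf :: "nat measure \<Rightarrow> (real \<Rightarrow> real) \<Rightarrow> bool" where
  "has_pgf N G \<longleftrightarrow> prob_space N \<and> sets N = sets (count_space UNIV) \<and>
     (\<forall>s\<in>{0..1}. (LINT n|N. s ^ n) = G s)"

definition is_BerG :: "real \<Rightarrow> real \<Rightarrow> nat measure \<Rightarrow> bool" where
  "is_BerG m r N \<longleftrightarrow> (m, r) \<in> params_R \<and> has_pgf N (berg_pgf m r)"

definition is_ZMG :: "real \<Rightarrow> real \<Rightarrow> nat measure \<Rightarrow> bool" where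
  "is_ZMG \<pi> \<mu> N \<longleftrightarrow> \<mu> > 0 \<and> - 1 / \<mu> < \<pi> \<and> \<pi> < 1 \<and> has_pgf N (zmg_pgf \<pi> \<mu>)"

abbreviation law :: "'a measure \<Rightarrow> ('a \<Rightarrow> nat) \<Rightarrow> nat measure" where
  "law M Y \<equiv> distr M (count_space UNIV) Y"

datatype noise = Initial | Innovation nat | Offspring nat nat

text \<open>Independence of the one family consisting of \<open>X 0\<close>, all \<open>\<epsilon> t\<close> with \<open>t \<ge> 1\<close> and all \<open>Z i t\<close>
  with \<open>i \<ge> 1\<close>, \<open>t \<ge> 0\<close> says at once that the \<open>\<epsilon> t\<close> are independent, that the \<open>Z i t\<close> are
  independent, and that \<open>X 0\<close>, the sequence \<open>\<epsilon>\<close> and the array \<open>Z\<close> are mutually independent.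
  Variables outside these index ranges (\<open>\<epsilon> 0\<close> and \<open>Z 0 t\<close>) are irrelevant.\<close>

locale INAR1_representation = prob_space M
  for M :: "'a measure" and m r :: real
    and X :: "nat \<Rightarrow> 'a \<Rightarrow> nat" and Z :: "nat \<Rightarrow> nat \<Rightarrow> 'a \<Rightarrow> nat" and \<epsilon> :: "nat \<Rightarrow> 'a \<Rightarrow> nat" +
  assumes params: "(m, r) \<in> params_R1"
    and X_measurable: "\<And>t. X t \<in> measurable M (count_space UNIV)"
    and indep: "indep_vars (\<lambda>_. count_space UNIV)
          (\<lambda>j. case j of Initial \<Rightarrow> X 0 | Innovation t \<Rightarrow> \<epsilon> t | Offspring i t \<Rightarrow> Z i t)
          ({Initial} \<union> {Innovation t | t. t \<ge> 1} \<union> {Offspring i t | i t. i \<ge> 1})"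
    and offspring_law: "\<And>i t. i \<ge> 1 \<Longrightarrow> has_pgf (law M (Z i t)) (berg_pgf m r)"
    and innovation_law: "\<And>t. t \<ge> 1 \<Longrightarrow> law M (\<epsilon> t) = law M (\<epsilon> 1)"
    and recursion: "\<And>t \<omega>. t \<ge> 1 \<Longrightarrow> \<omega> \<in> space M \<Longrightarrow>
          X t \<omega> = (\<Sum>i = 1..X (t - 1) \<omega>. Z i (t - 1) \<omega>) + \<epsilon> t \<omega>"

definition INAR1_process :: "'a measure \<Rightarrow> real \<Rightarrow> real \<Rightarrow> (nat \<Rightarrow> 'a \<Rightarrow> nat) \<Rightarrow> bool" where
  "INAR1_process M m r X \<longleftrightarrow> (\<exists>Z \<epsilon>. INAR1_representation M m r X Z \<epsilon>)"

definition strictly_stationary :: "'a measure \<Rightarrow> (nat \<Rightarrow> 'a \<Rightarrow> nat) \<Rightarrow> bool" where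
  "strictly_stationary M X \<longleftrightarrow>
     (\<forall>J h. finite J \<longrightarrow>
        distr M (Pi\<^sub>M J (\<lambda>_. count_space UNIV)) (\<lambda>\<omega>. \<lambda>t\<in>J. X (t + h) \<omega>) =
        distr M (Pi\<^sub>M J (\<lambda>_. count_space UNIV)) (\<lambda>\<omega>. \<lambda>t\<in>J. X t \<omega>))"

end

theory Submission
  imports Defs "HOL-Complex_Analysis.Cauchy_Integral_Formula"
begin

text \<open>
  Write \<open>G\<close> for the ZMG pgf, \<open>\<psi>\<close> for the offspring pgf and \<open>w = 1 - s\<close>. A law with pgf \<open>G\<close> is
  invariant for the INAR(1) recursion exactly when the innovation pgf is \<open>G s / G (\<psi> s)\<close>, so the
  point is to see that this quotient is a pgf. Put \<open>a = \<pi> * \<mu>\<close>, \<open>c = r + a * m\<close> and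
  \<open>d = r + \<mu> * m\<close>. Since \<open>1 - \<psi> s = m * w / (1 + r * w)\<close>, the quotient factors as
  \<open>((1 + a * w) / (1 + c * w)) * ((1 + d * w) / (1 + \<mu> * w))\<close>, and
  \<open>(1 + q * w) / (1 + p * w)\<close> is the BerG\<open>(p - q, p)\<close> pgf. The hypotheses give \<open>c > 0\<close>, \<open>a \<ge> -1\<close>,
  \<open>a < c\<close> and \<open>d < \<mu>\<close>, which makes both pairs of BerG parameters admissible: the innovation is the sum
  of two independent BerG variables (\<open>berg_innovation\<close>, \<open>berg_exists\<close>, \<open>pgf_convolution\<close>).

  The process lives on the space of noise sequences: independent coordinates carry the initial
  value, the innovations and the offspring counts, and \<open>gwi t\<close> computes \<open>X t\<close> from them. Replacing
  the initial value by \<open>X 1\<close> and moving all other noise one time step forward is a map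
  \<open>shift_slots\<close> with \<open>gwi (t + 1) = gwi t \<circ> shift_slots\<close>. It preserves the product measure
  (\<open>shift_preserves\<close>): the new coordinates depend on disjoint blocks of the old ones, and \<open>X 1\<close> has the
  law of \<open>X 0\<close> because the two pgfs agree (\<open>has_pgf_step\<close>, \<open>has_pgf_unique\<close>). Strict stationarity
  follows by iterating the map.
\<close>

section \<open>Probability generating functions\<close>

definition pgf :: "nat measure \<Rightarrow> real \<Rightarrow> real" where
  "pgf N s = (LINT n|N. s ^ n)"

text \<open>Conditioning on a discrete variable: applied below both to write a pgf as a power series and to
  condition on the current population size, which is the random number of summands.\<close>

lemma (in prob_space) expectation_sums_levels:
  fixes K :: "'a \<Rightarrow> nat" and Y :: "'a \<Rightarrow> real"
  assumes Y: "integrable M Y" and K: "K \<in> measurable M (count_space UNIV)"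
  shows "(\<lambda>n. expectation (\<lambda>\<omega>. indicator {n} (K \<omega>) * Y \<omega>)) sums expectation Y"
proof -
  let ?f = "\<lambda>n \<omega>. indicator {n} (K \<omega>) * Y \<omega>"
  have ind: "(\<lambda>\<omega>. indicator {n} (K \<omega>) :: real) \<in> borel_measurable M" for n
    by (rule measurable_compose[OF K]) simp
  have int: "integrable M (?f n)" for n
    using Y ind by (intro Bochner_Integration.integrable_bound[OF Y])
      (auto simp: indicator_def intro!: borel_measurable_times)
  have pt: "(\<lambda>n. ?f n \<omega>) sums Y \<omega>" for \<omega>
    using sums_single[of "K \<omega>" "\<lambda>n. ?f n \<omega>"] sums_cong[of "\<lambda>n. if n = K \<omega> then ?f n \<omega> else 0" "\<lambda>n. ?f n \<omega>"]
    by (auto simp: indicator_def)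
  have ptn: "(\<lambda>n. norm (?f n \<omega>)) sums norm (Y \<omega>)" for \<omega>
    using sums_single[of "K \<omega>" "\<lambda>n. norm (?f n \<omega>)"]
      sums_cong[of "\<lambda>n. if n = K \<omega> then norm (?f n \<omega>) else 0" "\<lambda>n. norm (?f n \<omega>)"]
    by (auto simp: indicator_def)
  have part: "(\<Sum>i<n. norm (?f i \<omega>)) \<le> norm (Y \<omega>)" for n \<omega>
    using sum_le_suminf[OF sums_summable[OF ptn], of "{..<n}" \<omega>] sums_unique[OF ptn, of \<omega>] by simp
  have "summable (\<lambda>n. LINT \<omega>|M. norm (?f n \<omega>))"
  proof (rule summableI_nonneg_bounded)
    fix n show "0 \<le> (LINT \<omega>|M. norm (?f n \<omega>))" by simp
  next
    fix n
    have "(\<Sum>i<n. LINT \<omega>|M. norm (?f i \<omega>)) = (LINT \<omega>|M. (\<Sum>i<n. norm (?f i \<omega>)))"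
      using int by (subst Bochner_Integration.integral_sum) auto
    also have "\<dots> \<le> (LINT \<omega>|M. norm (Y \<omega>))"
      using Y int part by (intro integral_mono) auto
    finally show "(\<Sum>i<n. LINT \<omega>|M. norm (?f i \<omega>)) \<le> (LINT \<omega>|M. norm (Y \<omega>))" .
  qed
  then have "(\<lambda>n. LINT \<omega>|M. ?f n \<omega>) sums (LINT \<omega>|M. (\<Sum>n. ?f n \<omega>))"
    using int sums_summable[OF ptn] by (intro sums_integral) auto
  then show ?thesis
    by (simp add: sums_unique[OF pt, symmetric])
qed

lemma pgf_sums:
  assumes "prob_space N" "sets N = sets (count_space UNIV)" "s \<in> {0..1}"
  shows "(\<lambda>n. measure N {n} * s ^ n) sums pgf N s"
proof -
  interpret prob_space N by fact
  have meas: "f \<in> measurable N L \<longleftrightarrow> f \<in> UNIV \<rightarrow> space L" for f and L :: "'c measure"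
    using measurable_cong_sets[OF assms(2) refl, of L] by simp
  have "integrable N (\<lambda>n. s ^ n)"
    using assms(3) by (intro integrable_const_bound[where B=1]) (auto simp: meas power_le_one)
  then have "(\<lambda>n. LINT k|N. indicator {n} k * s ^ k) sums pgf N s"
    using expectation_sums_levels[of "\<lambda>n. s ^ n" "\<lambda>n. n"] by (auto simp: pgf_def meas)
  moreover have "(LINT k|N. indicator {n} k * s ^ k) = measure N {n} * s ^ n" for n
  proof -
    have "(LINT k|N. indicator {n} k * s ^ k) = (LINT k|N. s ^ n * indicator {n} k)"
      by (intro Bochner_Integration.integral_cong) (auto simp: indicator_def)
    also have "\<dots> = s ^ n * measure N {n}"
      using sets_eq_imp_space_eq[OF assms(2)] by simp
    finally show ?thesis by simp
  qed
  ultimately show ?thesis by simp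
qed

text \<open>The difference of two mass functions with the same pgf gives a power series that vanishes on
  \<open>[0, 1]\<close>, whereas the zeros of a nonzero power series are isolated.\<close>

lemma has_pgf_unique:
  assumes "has_pgf N G" "has_pgf N' G"
  shows "N = N'"
proof -
  have N: "prob_space N" "sets N = sets (count_space UNIV)" "\<And>s. s \<in> {0..1} \<Longrightarrow> pgf N s = G s"
    and N': "prob_space N'" "sets N' = sets (count_space UNIV)" "\<And>s. s \<in> {0..1} \<Longrightarrow> pgf N' s = G s"
    using assms by (auto simp: has_pgf_def pgf_def)
  interpret N: prob_space N by fact
  interpret N': prob_space N' by fact
  define a where "a n = measure N {n} - measure N' {n}" for n
  have a_sums: "(\<lambda>n. a n * s ^ n) sums 0" if "s \<in> {0..1}" for s
    using sums_diff[OF pgf_sums[OF N(1,2) that] pgf_sums[OF N'(1,2) that]] N(3) N'(3) that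
    by (simp add: a_def algebra_simps)
  have a0: "a 0 = 0"
    using sums_unique2[OF a_sums[of 0] powser_sums_zero[of a]] by simp
  have "a m = 0" for m
  proof (rule ccontr)
    assume "a m \<noteq> 0"
    then have "m > 0" using a0 by (cases m) auto
    have sm: "summable (\<lambda>n. a n * x ^ n)" if "norm x < 1" for x
      by (rule powser_inside[of _ 1]) (use a_sums[of 1] that in \<open>auto simp: sums_iff\<close>)
    obtain s where s: "0 < s" "\<And>z. z \<in> cball 0 s - {0} \<Longrightarrow> (\<Sum>n. a n * z ^ n) \<noteq> 0"
      by (rule powser_0_nonzero[of 1 0 a "\<lambda>z. \<Sum>n. a n * z ^ n" m])
         (use sm a0 \<open>a m \<noteq> 0\<close> \<open>m > 0\<close> in \<open>auto simp: summable_sums\<close>)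
    then show False
      using s(2)[of "min s 1"] a_sums[of "min s 1"] by (auto simp: sums_iff)
  qed
  then have "measure N {n} = measure N' {n}" for n by (simp add: a_def)
  then show ?thesis
    using N(2) N'(2)
    by (intro measure_eqI_countable[of _ UNIV])
       (auto simp: N.emeasure_eq_measure N'.emeasure_eq_measure)
qed

lemma pgf_pmf_sums:
  assumes "s \<in> {0..1}"
  shows "(\<lambda>n. pmf p n * s ^ n) sums pgf (measure_pmf p) s"
  using pgf_sums[OF prob_space_measure_pmf _ assms, of p] by (simp add: measure_pmf_single)

lemma has_pgf_pmf_iff:
  "has_pgf (measure_pmf p) G \<longleftrightarrow> (\<forall>s\<in>{0..1}. pgf (measure_pmf p) s = G s)"
  by (simp add: has_pgf_def pgf_def prob_space_measure_pmf)

lemma pgf_bind_pmf: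
  assumes "s \<in> {0..1}"
  shows "pgf (bind_pmf p f) s = measure_pmf.expectation p (\<lambda>x. pgf (f x) s)"
  unfolding pgf_def measure_pmf_bind
  by (rule integral_bind[where K = "count_space UNIV" and B = 1 and B' = 1])
     (use assms in \<open>auto simp: power_le_one measure_pmf.finite_measure_axioms measure_pmf.emeasure_space_1 space_subprob_algebra measure_pmf.subprob_space_axioms\<close>)

lemma pgf_range:
  assumes "s \<in> {0..1}"
  shows "pgf (measure_pmf p) s \<in> {0..1}"
  using assms unfolding pgf_def
  by (auto intro!: Bochner_Integration.integral_nonneg measure_pmf.integral_le_const
      measure_pmf.integrable_const_bound[where B=1] simp: power_le_one)

lemma pgf_map_add:
  assumes "s \<in> {0..1}"
  shows "pgf (map_pmf ((+) k) p) s = s ^ k * pgf p s"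
  by (simp add: pgf_def power_add)

lemma pgf_convolution:
  assumes "s \<in> {0..1}"
  shows "pgf (bind_pmf p (\<lambda>k. map_pmf ((+) k) q)) s = pgf p s * pgf q s"
  unfolding pgf_bind_pmf[OF assms] pgf_map_add[OF assms] by (simp add: pgf_def)

section \<open>The BerG distribution\<close>

lemma pgf_geometric:
  assumes "0 < p" "p \<le> 1" "s \<in> {0..1}"
  shows "pgf (geometric_pmf p) s = p / (1 - (1 - p) * s)"
proof (rule sums_unique2)
  show "(\<lambda>n. pmf (geometric_pmf p) n * s ^ n) sums pgf (geometric_pmf p) s"
    by (rule pgf_pmf_sums) fact
  have "(1 - p) * s < 1"
    using assms mult_left_le[of s "1 - p"] by auto
  then have "(\<lambda>n. p * ((1 - p) * s) ^ n) sums (p * (1 / (1 - (1 - p) * s)))"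
    using assms by (intro sums_mult geometric_sums) (auto simp: abs_mult)
  then show "(\<lambda>n. pmf (geometric_pmf p) n * s ^ n) sums (p / (1 - (1 - p) * s))"
    using assms by (simp add: power_mult_distrib mult_ac)
qed

text \<open>A BerG variable is the product of a Bernoulli variable and an independent geometric variable
  on the positive integers; \<open>m \<le> r + 1\<close> is what makes \<open>m / (1 + r)\<close> a probability.\<close>

lemma berg_exists:
  assumes "(m, r) \<in> params_R"
  obtains p where "has_pgf (measure_pmf p) (berg_pgf m r)"
proof -
  have r: "r \<ge> 0" and m: "0 < m" "m \<le> r + 1" using assms by (auto simp: params_R_def)
  define \<alpha> where "\<alpha> = m / (1 + r)"
  have \<alpha>: "0 \<le> \<alpha>" "\<alpha> \<le> 1" using r m by (auto simp: \<alpha>_def field_simps)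
  define p where "p = bind_pmf (bernoulli_pmf \<alpha>)
    (\<lambda>b. if b then map_pmf ((+) 1) (geometric_pmf (1 / (1 + r))) else return_pmf 0)"
  have "pgf p s = berg_pgf m r s" if s: "s \<in> {0..1}" for s
  proof -
    have geo: "pgf (geometric_pmf (1 / (1 + r))) s = 1 / (1 + r * (1 - s))"
    proof -
      have "r * s \<le> r" using r s mult_left_le[of s r] by auto
      then have "1 + r * (1 - s) > 0" by (simp add: algebra_simps)
      moreover have "1 - (1 - 1 / (1 + r)) * s = (1 + r * (1 - s)) / (1 + r)"
        using r by (simp add: field_simps)
      ultimately show ?thesis
        using r s by (subst pgf_geometric) (auto simp: field_simps)
    qed
    have pos: "1 + r * (1 - s) > 0" using r s by (simp add: add_pos_nonneg)
    have "pgf p s = \<alpha> * (s * (1 / (1 + r * (1 - s)))) + (1 - \<alpha>)"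
      unfolding p_def pgf_bind_pmf[OF s]
      using \<alpha> pgf_map_add[OF s, of 1] geo by (simp add: pgf_def)
    also have "\<dots> = berg_pgf m r s"
      using r pos by (simp add: \<alpha>_def berg_pgf_def divide_simps) (simp add: algebra_simps)
    finally show ?thesis .
  qed
  then show ?thesis by (intro that[of p]) (simp add: has_pgf_pmf_iff)
qed

lemma zmg_pgf_eq_berg_pgf:
  assumes "\<mu> > 0" "s \<in> {0..1}"
  shows "zmg_pgf \<pi> \<mu> s = berg_pgf (\<mu> * (1 - \<pi>)) \<mu> s"
proof -
  have "1 + \<mu> * (1 - s) > 0" using assms by (simp add: add_pos_nonneg)
  then show ?thesis by (simp add: zmg_pgf_def berg_pgf_def field_simps)
qed

text \<open>With \<open>1 - (p - q) * v / (1 + p * v) = (1 + q * v) / (1 + p * v)\<close>, composing with the offspring pgf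
  replaces the coefficient \<open>q\<close> by \<open>r + q * m\<close> in numerator and denominator, the common factor
  \<open>1 + r * w\<close> cancelling; the remaining product telescopes.\<close>

lemma berg_innovation:
  fixes m r a b s :: real
  assumes "r \<ge> 0" "b > 0" "r + a * m > 0" "m > 0" "s \<in> {0..1}"
  shows "berg_pgf (b - a) b (berg_pgf m r s)
      * (berg_pgf (r + a * m - a) (r + a * m) s * berg_pgf (b - (r + b * m)) b s)
      = berg_pgf (b - a) b s"
proof -
  define w where "w = 1 - s"
  have w: "w \<ge> 0" using assms by (simp add: w_def)
  have frac: "1 - (p - q) * (v / (1 + p * v)) = (1 + q * v) / (1 + p * v)"
    if "1 + p * v > 0" for p q v :: real
    using that by (simp add: field_simps)
  have pos: "1 + r * w > 0" "1 + b * w > 0" "1 + (r + a * m) * w > 0" "1 + (r + b * m) * w > 0"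
    using assms w by (simp_all add: add_pos_nonneg)
  have bergs: "berg_pgf (p - q) p s = (1 + q * w) / (1 + p * w)" if "1 + p * w > 0" for p q
    using frac[OF that] by (simp only: berg_pgf_def w_def)
  let ?u = "m * (w / (1 + r * w))"
  have den: "1 + q * ?u = (1 + (r + q * m) * w) / (1 + r * w)" for q
    using pos by (simp add: field_simps)
  have "1 - (b - a) * (?u / (1 + b * ?u)) = (1 + a * ?u) / (1 + b * ?u)"
    by (rule frac) (unfold den, intro divide_pos_pos pos)
  also have "\<dots> = (1 + (r + a * m) * w) / (1 + (r + b * m) * w)"
    unfolding den using pos by simp
  finally have comp: "berg_pgf (b - a) b (berg_pgf m r s) = (1 + (r + a * m) * w) / (1 + (r + b * m) * w)"
    by (simp add: berg_pgf_def w_def)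
  show ?thesis
    unfolding comp bergs[OF pos(2)] bergs[OF pos(3)] using pos by simp
qed

section \<open>The process as a function of independent noise\<close>

lemma (in prob_space) indep_vars_blocks:
  assumes "indep_vars M' X I" "\<And>j. j \<in> L \<Longrightarrow> K j \<subseteq> I" "disjoint_family_on K L"
    and "\<And>j. j \<in> L \<Longrightarrow> g j \<in> measurable (PiM (K j) M') (N j)"
  shows "indep_vars N (\<lambda>j \<omega>. g j (\<lambda>i\<in>K j. X i \<omega>)) L"
  by (rule indep_vars_compose2[OF indep_vars_restrict[OF assms(1-3)] assms(4)])

text \<open>All noise is stored in one sequence: position 0 holds the initial value, \<open>slot 0 t\<close> the
  immigrants arriving in the step from \<open>t\<close> to \<open>t + 1\<close>, and \<open>slot i t\<close> with \<open>i \<ge> 1\<close> the offspring of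
  individual \<open>i\<close> of generation \<open>t\<close>. Innovations are thus indexed one below their usual time.\<close>

definition slot :: "nat \<Rightarrow> nat \<Rightarrow> nat" where
  "slot i t = Suc (prod_encode (i, t))"

lemma slot_neq_0 [simp]: "slot i t \<noteq> 0" "0 \<noteq> slot i t" "0 < slot i t"
  by (simp_all add: slot_def)

lemma slot_eq_iff [simp]: "slot i t = slot j u \<longleftrightarrow> i = j \<and> t = u"
  by (simp add: slot_def)

lemma slot_cases:
  obtains "k = 0" | i t where "k = slot i t"
  by (metis not0_implies_Suc prod_decode_inverse slot_def surj_pair)

text \<open>The Galton-Watson process with immigration.\<close>

primrec gwi :: "nat \<Rightarrow> (nat \<Rightarrow> nat) \<Rightarrow> nat" where
  "gwi 0 \<omega> = \<omega> 0"
| "gwi (Suc t) \<omega> = (\<Sum>i = 1..gwi t \<omega>. \<omega> (slot i t)) + \<omega> (slot 0 t)"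

text \<open>The noise seen by the process restarted at time 1.\<close>

definition shift_slots :: "(nat \<Rightarrow> nat) \<Rightarrow> nat \<Rightarrow> nat" where
  "shift_slots \<omega> k = (case k of 0 \<Rightarrow> gwi 1 \<omega>
     | Suc n \<Rightarrow> (case prod_decode n of (i, t) \<Rightarrow> \<omega> (slot i (Suc t))))"

lemma shift_slots_simps [simp]:
  "shift_slots \<omega> 0 = gwi 1 \<omega>"
  "shift_slots \<omega> (slot i t) = \<omega> (slot i (Suc t))"
  by (simp_all add: shift_slots_def slot_def)

lemma gwi_Suc_shift: "gwi (Suc t) \<omega> = gwi t (shift_slots \<omega>)"
  by (induction t) auto

abbreviation (input) seq_space :: "(nat \<Rightarrow> nat) measure" where
  "seq_space \<equiv> \<Pi>\<^sub>M k\<in>UNIV. count_space UNIV"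

lemma measurable_gwi: "gwi t \<in> measurable seq_space (count_space UNIV)"
proof (induction t)
  case 0
  then show ?case by (simp add: measurable_component_singleton)
next
  case (Suc t)
  have "(\<lambda>\<omega>. (\<Sum>i = 1..n. \<omega> (slot i t)) + \<omega> (slot 0 t)) \<in> measurable seq_space (count_space UNIV)" for n
    by measurable
  from measurable_compose_countable[OF this Suc] show ?case by simp
qed

lemma measurable_shift_slots: "shift_slots \<in> measurable seq_space seq_space"
proof (rule measurable_PiM_single')
  fix k :: nat
  show "(\<lambda>\<omega>. shift_slots \<omega> k) \<in> measurable seq_space (count_space UNIV)"
    by (cases k rule: slot_cases)
       (use measurable_gwi[of 1] in \<open>auto intro!: measurable_component_singleton\<close>)
qed auto

section \<open>Stationarity from an invariant initial law\<close>

text \<open>The assumption says that one step of the recursion maps \<open>init\<close> to itself.\<close>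

locale invariant_gwi =
  fixes init offspr immigr :: "nat pmf"
  assumes invariant: "\<And>s. s \<in> {0..1} \<Longrightarrow> pgf init (pgf offspr s) * pgf immigr s = pgf init s"
begin

definition slot_law :: "nat \<Rightarrow> nat pmf" where
  "slot_law k = (case k of 0 \<Rightarrow> init
     | Suc n \<Rightarrow> (if fst (prod_decode n) = 0 then immigr else offspr))"

lemma slot_law_simps [simp]:
  "slot_law 0 = init"
  "slot_law (slot 0 t) = immigr"
  "i > 0 \<Longrightarrow> slot_law (slot i t) = offspr"
  by (simp_all add: slot_law_def slot_def)

lemma slot_law_shift: "slot_law (slot i (Suc t)) = slot_law (slot i t)"
  by (cases "i = 0") auto

definition P :: "(nat \<Rightarrow> nat) measure" where
  "P = (\<Pi>\<^sub>M k\<in>UNIV. measure_pmf (slot_law k))"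

sublocale prob_space P
  unfolding P_def by (intro prob_space_PiM prob_space_measure_pmf)

lemma sets_P [measurable_cong]: "sets P = sets seq_space"
  unfolding P_def by (intro sets_PiM_cong) auto

lemma measurable_P: "measurable P N = measurable seq_space N"
  by (rule measurable_cong_sets[OF sets_P refl])

lemma measurable_P_coord: "(\<lambda>\<omega>. \<omega> k) \<in> measurable P (count_space UNIV)"
  unfolding measurable_P by (simp add: measurable_component_singleton)

lemma law_coord: "law P (\<lambda>\<omega>. \<omega> k) = measure_pmf (slot_law k)"
proof -
  have "distr P (measure_pmf (slot_law k)) (\<lambda>\<omega>. \<omega> k) = measure_pmf (slot_law k)"
    unfolding P_def by (rule distr_PiM_component) (auto intro: prob_space_measure_pmf)
  moreover have "law P (\<lambda>\<omega>. \<omega> k) = distr P (measure_pmf (slot_law k)) (\<lambda>\<omega>. \<omega> k)"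
    by (rule distr_cong) auto
  ultimately show ?thesis by simp
qed

lemma expectation_coord: "expectation (\<lambda>\<omega>. f (\<omega> k)) = measure_pmf.expectation (slot_law k) f"
  for f :: "nat \<Rightarrow> real"
  using integral_distr[OF measurable_P_coord[of k], of f] by (simp add: law_coord)

lemma indep_coords: "indep_vars (\<lambda>_. count_space UNIV) (\<lambda>k \<omega>. \<omega> k) UNIV"
proof (subst indep_vars_iff_distr_eq_PiM')
  show "distr P seq_space (\<lambda>\<omega>. \<lambda>k\<in>UNIV. \<omega> k) = (\<Pi>\<^sub>M k\<in>UNIV. law P (\<lambda>\<omega>. \<omega> k))"
    unfolding law_coord by (simp add: restrict_UNIV distr_id2 sets_P P_def[symmetric])
qed (auto intro: measurable_P_coord)

text \<open>Given \<open>X 0 = n\<close>, the variable \<open>X 1\<close> is a sum of \<open>n\<close> offspring counts and one immigration count,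
  all independent, so its conditional pgf is \<open>pgf offspr s ^ n * pgf immigr s\<close>. Averaging over \<open>n\<close>
  gives \<open>pgf init (pgf offspr s) * pgf immigr s\<close>, and the invariance assumption applies.\<close>

lemma has_pgf_step: "has_pgf (law P (gwi 1)) (pgf init)"
proof -
  have meas: "gwi 1 \<in> measurable P (count_space UNIV)"
    unfolding measurable_P by (rule measurable_gwi)
  have "pgf (law P (gwi 1)) s = pgf init s" if s: "s \<in> {0..1}" for s
  proof -
    have bdd: "norm (s ^ k) \<le> 1" for k using s by (simp add: power_le_one)
    have gen: "expectation (\<lambda>\<omega>. indicator {n} (\<omega> 0) * s ^ gwi 1 \<omega>)
        = pmf init n * pgf offspr s ^ n * pgf immigr s" for n
    proof -
      \<comment> \<open>The index set \<open>0, slot 0 0, ..., slot n 0\<close> no longer depends on \<open>X 0\<close>, so the integrand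
        is a product of functions of finitely many independent coordinates.\<close>
      let ?Y = "\<lambda>k x. if k = 0 then indicator {n} x else s ^ x :: real"
      let ?J = "insert 0 ((\<lambda>i. slot i 0) ` {0..n})"
      have inj: "inj_on (\<lambda>i. slot i 0) {0..n}" by (auto simp: inj_on_def)
      have prod_J: "(\<Prod>k\<in>?J. h k) = h 0 * (h (slot 0 0) * (\<Prod>i=1..n. h (slot i 0)))" for h :: "nat \<Rightarrow> real"
        by (subst prod.insert) (auto simp: prod.reindex[OF inj] prod.atLeast_Suc_atMost)
      have "expectation (\<lambda>\<omega>. indicator {n} (\<omega> 0) * s ^ gwi 1 \<omega>) = expectation (\<lambda>\<omega>. \<Prod>k\<in>?J. ?Y k (\<omega> k))"
        unfolding prod_J
        by (intro Bochner_Integration.integral_cong) (auto simp: indicator_def power_add power_sum)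
      also have "\<dots> = (\<Prod>k\<in>?J. expectation (\<lambda>\<omega>. ?Y k (\<omega> k)))"
      proof (rule indep_vars_lebesgue_integral)
        show "indep_vars (\<lambda>_. borel) (\<lambda>k \<omega>. ?Y k (\<omega> k)) ?J"
          by (rule indep_vars_compose2[OF indep_vars_subset[OF indep_coords]]) auto
        show "integrable P (\<lambda>\<omega>. ?Y k (\<omega> k))" for k
          using bdd measurable_compose[OF measurable_P_coord[of k], of "?Y k" borel]
          by (intro integrable_const_bound[where B=1]) (auto simp: indicator_def)
      qed simp
      also have "\<dots> = pmf init n * pgf offspr s ^ n * pgf immigr s"
      proof -
        have "(\<Prod>k\<in>?J. expectation (\<lambda>\<omega>. ?Y k (\<omega> k)))
            = (\<Prod>k\<in>?J. measure_pmf.expectation (slot_law k) (?Y k))"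
          by (intro prod.cong refl expectation_coord)
        then show ?thesis
          unfolding prod_J by (simp add: pgf_def pmf.rep_eq)
      qed
      finally show ?thesis .
    qed
    have "integrable P (\<lambda>\<omega>. s ^ gwi 1 \<omega>)"
      using bdd measurable_compose[OF meas, of "\<lambda>x. s ^ x" borel]
      by (intro integrable_const_bound[where B=1]) auto
    from expectation_sums_levels[OF this measurable_P_coord[of 0]]
    have "(\<lambda>n. pmf init n * pgf offspr s ^ n * pgf immigr s) sums expectation (\<lambda>\<omega>. s ^ gwi 1 \<omega>)"
      unfolding gen .
    moreover have "(\<lambda>n. pmf init n * pgf offspr s ^ n * pgf immigr s) sums
        (pgf init (pgf offspr s) * pgf immigr s)"
      by (intro sums_mult2 pgf_pmf_sums pgf_range s)
    ultimately have "expectation (\<lambda>\<omega>. s ^ gwi 1 \<omega>) = pgf init (pgf offspr s) * pgf immigr s"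
      by (rule sums_unique2)
    then show ?thesis
      using invariant[OF s] integral_distr[OF meas, of "\<lambda>x. s ^ x"] by (simp add: pgf_def)
  qed
  then show ?thesis
    using prob_space_distr[OF meas] by (simp add: has_pgf_def pgf_def)
qed

lemma law_step: "law P (gwi 1) = measure_pmf init"
  by (rule has_pgf_unique[OF has_pgf_step]) (simp add: has_pgf_pmf_iff)

lemma measurable_P_shift: "shift_slots \<in> measurable P P"
  using measurable_shift_slots measurable_cong_sets[OF sets_P sets_P] by simp

text \<open>The shifted coordinate 0 is \<open>X 1\<close>, a function of the initial value and the noise of the first
  step; every other shifted coordinate is a single later noise variable. These blocks are disjoint,
  so the shifted coordinates are independent, and their laws are the original ones.\<close>

lemma shift_preserves: "distr P P shift_slots = P"
proof -
  \<comment> \<open>\<open>K k\<close> is the set of coordinates that determine coordinate \<open>k\<close> of the shifted sequence.\<close>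
  define K where "K k = (case k of 0 \<Rightarrow> insert 0 (range (\<lambda>i. slot i 0))
    | Suc n \<Rightarrow> {slot (fst (prod_decode n)) (Suc (snd (prod_decode n)))})" for k
  have K: "K 0 = insert 0 (range (\<lambda>i. slot i 0))" "K (slot i t) = {slot i (Suc t)}" for i t
    by (simp_all add: K_def slot_def)
  define g :: "nat \<Rightarrow> (nat \<Rightarrow> nat) \<Rightarrow> nat" where "g k y = shift_slots y k" for k y
  have gwi_1: "gwi 1 \<in> measurable (PiM (K 0) (\<lambda>_. count_space UNIV)) (count_space UNIV)"
  proof -
    have c: "(\<lambda>y. y k) \<in> measurable (PiM (K 0) (\<lambda>_. count_space UNIV)) (count_space UNIV)"
      if "k \<in> K 0" for k
      using that by (rule measurable_component_singleton)
    have "(\<lambda>y::nat \<Rightarrow> nat. (\<Sum>i = 1..n. y (slot i 0)) + y (slot 0 0))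
        \<in> measurable (PiM (K 0) (\<lambda>_. count_space UNIV)) (count_space UNIV)" for n
    proof -
      \<comment> \<open>With the evaluation hidden behind a name, the measurability prover does not split
        \<open>y (slot i 0)\<close> into a measurable choice of \<open>y\<close> and of the slot.\<close>
      define f :: "nat \<Rightarrow> (nat \<Rightarrow> nat) \<Rightarrow> nat" where "f i y = y (slot i 0)" for i y
      have [measurable]: "f i \<in> measurable (PiM (K 0) (\<lambda>_. count_space UNIV)) (count_space UNIV)" for i
        unfolding f_def by (rule c) (simp add: K)
      have "(\<lambda>y. (\<Sum>i = 1..n. f i y) + f 0 y)
          \<in> measurable (PiM (K 0) (\<lambda>_. count_space UNIV)) (count_space UNIV)"
        by measurable
      then show ?thesis by (simp add: f_def)
    qed
    from measurable_compose_countable[OF this c[of 0]]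
    have "(\<lambda>y. (\<Sum>i = 1..y 0. y (slot i 0)) + y (slot 0 0))
        \<in> measurable (PiM (K 0) (\<lambda>_. count_space UNIV)) (count_space UNIV)"
      by (simp add: K)
    moreover have "gwi 1 = (\<lambda>y. (\<Sum>i = 1..y 0. y (slot i 0)) + y (slot 0 0))"
      by (simp add: fun_eq_iff)
    ultimately show ?thesis by (simp only:)
  qed
  have "indep_vars (\<lambda>_. count_space UNIV) (\<lambda>k \<omega>. g k (\<lambda>i\<in>K k. \<omega> i)) UNIV"
  proof (rule indep_vars_blocks[OF indep_coords])
    show "disjoint_family_on K UNIV"
      unfolding disjoint_family_on_def
    proof safe
      fix k l x assume "k \<noteq> l" "x \<in> K k" "x \<in> K l"
      then show "x \<in> {}"
        by (cases k rule: slot_cases; cases l rule: slot_cases) (auto simp: K)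
    qed
    show "g k \<in> measurable (PiM (K k) (\<lambda>_. count_space UNIV)) (count_space UNIV)" for k
      by (cases k rule: slot_cases)
         (use gwi_1 in \<open>auto simp: g_def [abs_def] K intro!: measurable_component_singleton\<close>)
  qed simp
  moreover have "g k (\<lambda>i\<in>K k. \<omega> i) = shift_slots \<omega> k" for k \<omega>
    by (cases k rule: slot_cases) (auto simp: g_def K)
  ultimately have indep: "indep_vars (\<lambda>_. count_space UNIV) (\<lambda>k \<omega>. shift_slots \<omega> k) UNIV"
    by simp
  have coord: "(\<lambda>\<omega>. shift_slots \<omega> k) \<in> measurable P (count_space UNIV)" for k
    using measurable_compose[OF measurable_P_shift measurable_P_coord] by simp
  have laws: "law P (\<lambda>\<omega>. shift_slots \<omega> k) = measure_pmf (slot_law k)" for k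
    by (cases k rule: slot_cases) (use law_step in \<open>auto simp: law_coord slot_law_shift simp del: gwi.simps\<close>)
  have "distr P seq_space (\<lambda>\<omega>. \<lambda>k\<in>UNIV. shift_slots \<omega> k)
      = (\<Pi>\<^sub>M k\<in>UNIV. law P (\<lambda>\<omega>. shift_slots \<omega> k))"
    using indep coord by (subst (asm) indep_vars_iff_distr_eq_PiM') auto
  also have "\<dots> = P" unfolding laws by (rule P_def [symmetric])
  finally show ?thesis by (simp add: sets_P restrict_UNIV cong: distr_cong)
qed

lemma law_gwi: "law P (gwi t) = measure_pmf init"
proof (induction t)
  case 0
  show ?case using law_coord[of 0] by simp
next
  case (Suc t)
  have "law P (gwi (Suc t)) = law (distr P P shift_slots) (gwi t)"
    by (subst distr_distr[OF _ measurable_P_shift])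
       (simp_all add: measurable_P measurable_gwi gwi_Suc_shift [abs_def] comp_def del: gwi.simps)
  then show ?case using Suc by (simp only: shift_preserves)
qed

lemma strictly_stationary_gwi: "strictly_stationary P gwi"
  unfolding strictly_stationary_def
proof (intro allI impI)
  fix J :: "nat set" and h
  let ?S = "\<Pi>\<^sub>M t\<in>J. count_space UNIV :: nat measure"
  have meas: "(\<lambda>\<omega>. \<lambda>t\<in>J. gwi (t + h) \<omega>) \<in> measurable P ?S" for h
    unfolding measurable_P by (intro measurable_restrict measurable_gwi)
  show "distr P ?S (\<lambda>\<omega>. \<lambda>t\<in>J. gwi (t + h) \<omega>) = distr P ?S (\<lambda>\<omega>. \<lambda>t\<in>J. gwi t \<omega>)"
  proof (induction h)
    case (Suc h)
    have "distr P ?S (\<lambda>\<omega>. \<lambda>t\<in>J. gwi (t + Suc h) \<omega>)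
        = distr (distr P P shift_slots) ?S (\<lambda>\<omega>. \<lambda>t\<in>J. gwi (t + h) \<omega>)"
      by (subst distr_distr[OF meas measurable_P_shift])
         (simp add: gwi_Suc_shift comp_def del: gwi.simps)
    then show ?case using Suc by (simp only: shift_preserves)
  qed simp
qed

text \<open>Each noise variable of the representation is one coordinate, given by \<open>idx\<close>; the innovation at
  time \<open>t \<ge> 1\<close> sits in \<open>slot 0 (t - 1)\<close>. The map \<open>idx\<close> is injective for \<open>t \<ge> 1\<close> and \<open>i \<ge> 1\<close>, so the
  noise variables inherit independence from the coordinates.\<close>

lemma INAR1_gwi:
  assumes "(m, r) \<in> params_R1" and offspr: "has_pgf offspr (berg_pgf m r)"
  shows "INAR1_process P m r gwi"
proof -
  define Z :: "nat \<Rightarrow> nat \<Rightarrow> (nat \<Rightarrow> nat) \<Rightarrow> nat" where "Z i t \<omega> = \<omega> (slot i t)" for i t \<omega>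
  define \<epsilon> :: "nat \<Rightarrow> (nat \<Rightarrow> nat) \<Rightarrow> nat" where "\<epsilon> t \<omega> = \<omega> (slot 0 (t - 1))" for t \<omega>
  define idx where "idx j = (case j of Initial \<Rightarrow> 0 | Innovation t \<Rightarrow> slot 0 (t - 1) | Offspring i t \<Rightarrow> slot i t)" for j
  let ?I = "{Initial} \<union> {Innovation t | t. t \<ge> 1} \<union> {Offspring i t | i t. i \<ge> 1}"
  have "INAR1_representation P m r gwi Z \<epsilon>"
  proof
    show "(m, r) \<in> params_R1" by fact
    show "gwi t \<in> measurable P (count_space UNIV)" for t
      unfolding measurable_P by (rule measurable_gwi)
    have "indep_vars (\<lambda>_. count_space UNIV) (\<lambda>j \<omega>. (\<lambda>y. y (idx j)) (\<lambda>i\<in>{idx j}. \<omega> i)) ?I"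
      by (rule indep_vars_blocks[OF indep_coords])
         (auto simp: disjoint_family_on_def idx_def intro!: measurable_component_singleton)
    also have "(\<lambda>j \<omega>. (\<lambda>y. y (idx j)) (\<lambda>i\<in>{idx j}. \<omega> i)) =
        (\<lambda>j. case j of Initial \<Rightarrow> gwi 0 | Innovation t \<Rightarrow> \<epsilon> t | Offspring i t \<Rightarrow> Z i t)"
      by (auto simp: fun_eq_iff idx_def Z_def \<epsilon>_def split: noise.split)
    finally show "indep_vars (\<lambda>_. count_space UNIV)
        (\<lambda>j. case j of Initial \<Rightarrow> gwi 0 | Innovation t \<Rightarrow> \<epsilon> t | Offspring i t \<Rightarrow> Z i t) ?I" .
    show "has_pgf (law P (Z i t)) (berg_pgf m r)" if "i \<ge> 1" for i t
      using that offspr by (simp add: Z_def [abs_def] law_coord)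
    show "law P (\<epsilon> t) = law P (\<epsilon> 1)" for t
      by (simp add: \<epsilon>_def [abs_def] law_coord)
    show "gwi t \<omega> = (\<Sum>i = 1..gwi (t - 1) \<omega>. Z i (t - 1) \<omega>) + \<epsilon> t \<omega>" if "t \<ge> 1" for t \<omega>
      using that by (cases t) (auto simp: Z_def \<epsilon>_def)
  qed
  then show ?thesis unfolding INAR1_process_def by blast
qed

end

section \<open>Existence of the stationary process\<close>

theorem mainTheorem11:
  fixes m r \<pi> \<mu> :: real
  assumes "(m, r) \<in> params_R1"
    and "\<mu> > 0" and "- 1 / \<mu> < \<pi>" and "\<pi> < 1"
    and "- min (r / m) 1 < \<pi> * \<mu>" and "\<pi> * \<mu> < r / (1 - m)"
    and "\<mu> > r / (1 - m)"
  shows "\<exists>(M :: (nat \<Rightarrow> nat) measure) X.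
           INAR1_process M m r X \<and> strictly_stationary M X \<and>
           (\<forall>t. is_ZMG \<pi> \<mu> (law M (X t)) \<and> is_BerG (\<mu> * (1 - \<pi>)) \<mu> (law M (X t)))"
proof -
  have mr: "r \<ge> 0" "0 < m" "m < 1" using assms(1) by (auto simp: params_R1_def)
  define a where "a = \<pi> * \<mu>"
  define c where "c = r + a * m"
  define d where "d = r + \<mu> * m"
  have eq: "\<mu> * (1 - \<pi>) = \<mu> - a" by (simp add: a_def algebra_simps)
  have a: "a < \<mu>" "- 1 < a" "- r / m < a"
    using assms(2,4,5) by (auto simp: a_def)
  have c: "c > 0" "a < c"
    using a mr assms(6) unfolding c_def a_def[symmetric] by (auto simp: field_simps)
  have d: "0 < d" "d < \<mu>"
    using assms(2,7) mr by (auto simp: d_def field_simps intro: add_nonneg_pos)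
  have R: "(m, r) \<in> params_R" "(\<mu> - a, \<mu>) \<in> params_R" "(c - a, c) \<in> params_R" "(\<mu> - d, \<mu>) \<in> params_R"
    using mr a c d assms(2) by (auto simp: params_R_def)
  obtain offspr where offspr: "has_pgf (measure_pmf offspr) (berg_pgf m r)"
    using berg_exists[OF R(1)] .
  obtain init where init: "has_pgf (measure_pmf init) (berg_pgf (\<mu> - a) \<mu>)"
    using berg_exists[OF R(2)] .
  obtain p where p: "has_pgf (measure_pmf p) (berg_pgf (c - a) c)"
    using berg_exists[OF R(3)] .
  obtain q where q: "has_pgf (measure_pmf q) (berg_pgf (\<mu> - d) \<mu>)"
    using berg_exists[OF R(4)] .
  define immigr where "immigr = bind_pmf p (\<lambda>k. map_pmf ((+) k) q)"
  interpret invariant_gwi init offspr immigr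
  proof
    fix s :: real assume s: "s \<in> {0..1}"
    have "pgf offspr s \<in> {0..1}"
      using pgf_range[OF s] .
    then show "pgf init (pgf offspr s) * pgf immigr s = pgf init s"
      using berg_innovation[of r \<mu> a m s] s offspr init p q mr c assms(2)
      by (simp add: immigr_def pgf_convolution has_pgf_pmf_iff c_def d_def)
  qed
  have "is_BerG (\<mu> * (1 - \<pi>)) \<mu> (law P (gwi t))" for t
    using R(2) init by (simp add: is_BerG_def law_gwi eq)
  moreover have "is_ZMG \<pi> \<mu> (law P (gwi t))" for t
    using assms(2-4) init by (simp add: is_ZMG_def law_gwi has_pgf_pmf_iff zmg_pgf_eq_berg_pgf eq)
  ultimately show ?thesis
    using INAR1_gwi[OF assms(1) offspr] strictly_stationary_gwi by blast
qed

end
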